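(* Let $\mathcal{A}$ be a finite nonempty action set, $D,T\ge 1$ integers, $\tau>0$ and $\eta>0$. Fix an encoder $\boldsymbol{\phi}:\mathcal{X}\to\mathbb{R}^D$ with $\|\boldsymbol{\phi}(x)\|_2=1$ for all $x\in\mathcal{X}$. Let $x_1,\dots,x_T\in\mathcal{X}$, $a_1,\dots,a_T\in\mathcal{A}$, and let $A_1,\dots,A_T\in\mathbb{R}$ be arbitrary (advantages, treated as constants). For $\mathbf{C}\in\mathbb{R}^{|\mathcal{A}|\times D}$ with rows $\mathbf{c}_a$, let $$\pi_{\mathbf{C}}(a\mid x)=\frac{\exp(\tau\,\mathbf{c}_a^\top\boldsymbol{\phi}(x))}{\sum_{b\in\mathcal{A}}\exp(\tau\,\mathbf{c}_b^\top\boldsymbol{\phi}(x))},\qquad \hat J(\mathbf{C})=\sum_{t=1}^T A_t\log\pi_{\mathbf{C}}(a_t\mid x_t).$$ Let $\mathbf{S}\in\mathbb{R}^{T\times D}$ be the matrix whose $t$-th row is $\boldsymbol{\phi}(x_t)^\top$, and let $\boldsymbol{\Lambda}\in\mathbb{R}^{T\times|\mathcal{A}|}$ have entries $$\Lambda_{t,a}=A_t\,\tau\,\bigl(\mathbf{1}[a=a_t]-\pi_{\mathbf{C}}(a\mid x_t)\bigr).$$ Then $$\nabla_{\mathbf{C}}\hat J(\mathbf{C})=\boldsymbol{\Lambda}^\top\mathbf{S}.$$ Consequently the update $$\mathbf{C}\leftarrow\operatorname{row\text{-}norm}\bigl(\mathbf{C}+\eta\,\boldsymbol{\Lambda}^\top\mathbf{S}\bigr)$$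 is a gradient-ascent step of size $\eta$ on $\hat J$ followed by row-wise Euclidean projection onto the unit sphere; that is, each row of the updated matrix is the unique unit vector in $\mathbb{R}^D$ closest in Euclidean distance to the corresponding row of $\mathbf{C}+\eta\nabla_{\mathbf{C}}\hat J(\mathbf{C})$.
   Context: $\operatorname{row\text{-}norm}(\mathbf{M})$ denotes the matrix obtained from $\mathbf{M}$ by dividing each row by its Euclidean norm; it is defined when every row of $\mathbf{M}$ is nonzero, which is assumed of $\mathbf{C}+\eta\boldsymbol{\Lambda}^\top\mathbf{S}$ whenever the update is considered. The gradient $\nabla_{\mathbf{C}}$ is the ordinary Euclidean gradient on $\mathbb{R}^{|\mathcal{A}|\times D}$, arranged as an $|\mathcal{A}|\times D$ matrix. $\mathbf{1}[\cdot]$ is the indicator. *)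

theory Defs
  imports "HOL-Analysis.Analysis"
begin

(* The inner product on real^'d^'a is the entrywise (Frobenius) one, so for a function of a
   matrix GDERIV is the ordinary Euclidean gradient, arranged as a matrix of the same shape.
   The description below is only meaningful where a gradient exists; see gradient_eqI. *)
definition gradient :: "('v::real_inner \<Rightarrow> real) \<Rightarrow> 'v \<Rightarrow> 'v" where
  "gradient f x = (THE D. GDERIV f x :> D)"

lemma gradient_eqI:
  assumes "GDERIV f x :> D"
  shows "gradient f x = D"
  unfolding gradient_def
proof (rule the_equality)
  show "GDERIV f x :> D" by (fact assms)
next
  fix E assume "GDERIV f x :> E"
  with assms have "(\<lambda>h. inner h E) = (\<lambda>h. inner h D)"
    unfolding gderiv_def by (metis has_derivative_unique)
  then have "inner (E - D) (E - D) = 0"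
    by (metis inner_diff_right diff_self)
  then show "E = D" by simp
qed

definition policy ::
  "real \<Rightarrow> ('x \<Rightarrow> real^'d) \<Rightarrow> real^'d^'a \<Rightarrow> 'a \<Rightarrow> 'x \<Rightarrow> real" where
  "policy \<tau> \<phi> C a x =
     exp (\<tau> * (C $ a \<bullet> \<phi> x)) / (\<Sum>b\<in>UNIV. exp (\<tau> * (C $ b \<bullet> \<phi> x)))"

definition surrogate ::
  "real \<Rightarrow> ('x \<Rightarrow> real^'d) \<Rightarrow> ('t::finite \<Rightarrow> 'x) \<Rightarrow> ('t \<Rightarrow> 'a) \<Rightarrow> ('t \<Rightarrow> real)
     \<Rightarrow> real^'d^'a \<Rightarrow> real" where
  "surrogate \<tau> \<phi> xs as Adv C = (\<Sum>t\<in>UNIV. Adv t * ln (policy \<tau> \<phi> C (as t) (xs t)))"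

definition feature_matrix ::
  "('x \<Rightarrow> real^'d) \<Rightarrow> ('t::finite \<Rightarrow> 'x) \<Rightarrow> real^'d^'t" where
  "feature_matrix \<phi> xs = (\<chi> t. \<phi> (xs t))"

definition Lambda_matrix ::
  "real \<Rightarrow> ('x \<Rightarrow> real^'d) \<Rightarrow> ('t::finite \<Rightarrow> 'x) \<Rightarrow> ('t \<Rightarrow> 'a) \<Rightarrow> ('t \<Rightarrow> real)
     \<Rightarrow> real^'d^'a \<Rightarrow> real^'a^'t" where
  "Lambda_matrix \<tau> \<phi> xs as Adv C =
     (\<chi> t a. Adv t * \<tau> * (of_bool (a = as t) - policy \<tau> \<phi> C a (xs t)))"

(* Intended for matrices all of whose rows are nonzero; a zero row would be left unchanged. *)
definition row_norm :: "real^'d^'a \<Rightarrow> real^'d^'a" where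
  "row_norm M = (\<chi> a. M $ a /\<^sub>R norm (M $ a))"

end

theory Submission
  imports Defs
begin

text \<open>The log-policy is a linear score minus the log-partition function, so its gradient in the
  row of action \<open>b\<close> is \<open>\<tau> (1[b = a] - \<pi> b)\<close> times the feature vector; summing over
  \<open>t\<close> with weights \<open>Adv t\<close> gives \<open>\<Lambda>\<^sup>T S\<close>. On the unit sphere the squared distance to \<open>m\<close> is
  \<open>1 - 2 v \<bullet> m + |m|\<^sup>2\<close>, so the nearest unit vector is the one attaining equality in Cauchy-Schwarz.\<close>

text \<open>The equivalence packs existence (right to left) and uniqueness (left to right) of the
  nearest unit vector into one rewrite rule.\<close>

lemma is_arg_min_dist_sphere_iff:
  fixes m u :: "'v::real_inner"
  assumes "m \<noteq> 0"
  shows "is_arg_min (\<lambda>v. dist v m) (\<lambda>v. norm v = 1) u \<longleftrightarrow> u = m /\<^sub>R norm m"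
proof -
  have dist_less: "dist v m < dist w m \<longleftrightarrow> w \<bullet> m < v \<bullet> m" if "norm v = 1" "norm w = 1" for v w :: 'v
  proof -
    have "(dist z m)\<^sup>2 = 1 - 2 * (z \<bullet> m) + (norm m)\<^sup>2" if "norm z = 1" for z
      using that by (simp add: dist_norm power2_norm_eq_inner inner_diff inner_commute norm_eq_1)
    moreover have "dist v m < dist w m \<longleftrightarrow> (dist v m)\<^sup>2 < (dist w m)\<^sup>2"
      by (metis power2_less_imp_less power_strict_mono zero_le_dist zero_less_numeral)
    ultimately show ?thesis
      using that by simp
  qed
  define p where "p = m /\<^sub>R norm m"
  have p: "norm p = 1" "p \<bullet> m = norm m"
    using assms by (simp_all add: p_def power2_norm_eq_inner[symmetric] power2_eq_square)
  have le: "v \<bullet> m \<le> norm m" if "norm v = 1" for v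
    using norm_cauchy_schwarz[of v m] that by simp
  have eq: "v = p" if "norm v = 1" "v \<bullet> m = norm m" for v
  proof -
    \<comment> \<open>Equality in Cauchy-Schwarz forces
      \<open>norm v *\<^sub>R m = norm m *\<^sub>R v\<close>, and \<open>v\<close> has norm
      1.\<close>
    have "m = norm m *\<^sub>R v"
      using norm_cauchy_schwarz_eq[of v m] that by simp
    then have "p = (norm m *\<^sub>R v) /\<^sub>R norm m"
      by (simp add: p_def)
    then show ?thesis
      using assms by simp
  qed
  \<comment> \<open>Being an arg min means that no unit vector is strictly closer, which
    \<open>dist_less\<close> turns into maximality of the inner product with
    \<open>m\<close>.\<close>
  have "is_arg_min (\<lambda>v. dist v m) (\<lambda>v. norm v = 1) u \<longleftrightarrow>
      norm u = 1 \<and> (\<forall>v. norm v = 1 \<longrightarrow> v \<bullet> m \<le> u \<bullet> m)"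
    unfolding is_arg_min_def using dist_less by (meson not_le)
  also have "\<dots> \<longleftrightarrow> u = p"
    using p le eq by (metis order_antisym)
  finally show ?thesis
    by (simp add: p_def)
qed

lemma ln_policy:
  fixes C :: "real^'d^'a::finite"
  shows "ln (policy \<tau> \<phi> C a x) =
    \<tau> * (C $ a \<bullet> \<phi> x) - ln (\<Sum>b\<in>UNIV. exp (\<tau> * (C $ b \<bullet> \<phi> x)))"
proof -
  have "(\<Sum>b\<in>UNIV. exp (\<tau> * (C $ b \<bullet> \<phi> x))) > 0"
    by (auto intro!: sum_pos)
  then show ?thesis
    by (simp add: policy_def ln_div)
qed

text \<open>Differentiating the log-partition function in direction \<open>h\<close> averages
  \<open>\<tau> * (h $ b \<bullet> \<phi> x)\<close> over the policy, since each exponential divided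
  by the partition function is a policy probability.\<close>

lemma GDERIV_ln_policy:
  fixes C :: "real^'d^'a::finite"
  shows "GDERIV (\<lambda>C. ln (policy \<tau> \<phi> C a x)) C :>
    (\<chi> b. (\<tau> * (of_bool (b = a) - policy \<tau> \<phi> C b x)) *\<^sub>R \<phi> x)"
proof -
  define Z where "Z = (\<Sum>b\<in>UNIV. exp (\<tau> * (C $ b \<bullet> \<phi> x)))"
  have Z: "Z > 0"
    unfolding Z_def by (auto intro!: sum_pos)
  have "((\<lambda>C. ln (policy \<tau> \<phi> C a x)) has_derivative
      (\<lambda>h. \<tau> * (h $ a \<bullet> \<phi> x) -
        (\<Sum>b\<in>UNIV. exp (\<tau> * (C $ b \<bullet> \<phi> x)) * (\<tau> * (h $ b \<bullet> \<phi> x))) / Z)) (at C)"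
    unfolding ln_policy using Z
    by (auto intro!: derivative_eq_intros bounded_linear.has_derivative[OF bounded_linear_vec_nth]
        simp: Z_def divide_inverse mult_ac)
  \<comment> \<open>The gradient is the matrix representing this linear functional in the Frobenius
    inner product, read off row by row.\<close>
  also have "(\<lambda>h. \<tau> * (h $ a \<bullet> \<phi> x) -
        (\<Sum>b\<in>UNIV. exp (\<tau> * (C $ b \<bullet> \<phi> x)) * (\<tau> * (h $ b \<bullet> \<phi> x))) / Z) =
      (\<lambda>h. h \<bullet> (\<chi> b. (\<tau> * (of_bool (b = a) - policy \<tau> \<phi> C b x)) *\<^sub>R \<phi> x))"
  proof
    fix h :: "real^'d^'a"
    have "h \<bullet> (\<chi> b. (\<tau> * (of_bool (b = a) - policy \<tau> \<phi> C b x)) *\<^sub>R \<phi> x) =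
        (\<Sum>b\<in>UNIV. of_bool (b = a) * (\<tau> * (h $ b \<bullet> \<phi> x))) -
        (\<Sum>b\<in>UNIV. policy \<tau> \<phi> C b x * (\<tau> * (h $ b \<bullet> \<phi> x)))"
      \<comment> \<open>The instance at \<open>h\<close> expands only the matrix inner product into
        rows and leaves the inner products of rows intact.\<close>
      by (simp add: inner_vec_def[of h] sum_subtractf[symmetric] algebra_simps)
    also have "(\<Sum>b\<in>UNIV. of_bool (b = a) * (\<tau> * (h $ b \<bullet> \<phi> x))) = \<tau> * (h $ a \<bullet> \<phi> x)"
      by (simp add: of_bool_def if_distrib[of "\<lambda>c. c * _"] cong: if_cong)
    also have "(\<Sum>b\<in>UNIV. policy \<tau> \<phi> C b x * (\<tau> * (h $ b \<bullet> \<phi> x))) =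
        (\<Sum>b\<in>UNIV. exp (\<tau> * (C $ b \<bullet> \<phi> x)) * (\<tau> * (h $ b \<bullet> \<phi> x))) / Z"
      by (simp add: policy_def Z_def sum_divide_distrib)
    finally show "\<tau> * (h $ a \<bullet> \<phi> x) -
        (\<Sum>b\<in>UNIV. exp (\<tau> * (C $ b \<bullet> \<phi> x)) * (\<tau> * (h $ b \<bullet> \<phi> x))) / Z =
      h \<bullet> (\<chi> b. (\<tau> * (of_bool (b = a) - policy \<tau> \<phi> C b x)) *\<^sub>R \<phi> x)"
      by (rule sym)
  qed
  finally show ?thesis
    unfolding gderiv_def .
qed

text \<open>Splits the matrix product into one rank-one term per time index, so that it matches the
  gradient of the surrogate summand by summand.\<close>

lemma transpose_Lambda_matrix_mult_feature_matrix:
  fixes xs :: "'t::finite \<Rightarrow> 'x" and as :: "'t \<Rightarrow> 'a::finite"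
  shows "transpose (Lambda_matrix \<tau> \<phi> xs as Adv C) ** feature_matrix \<phi> xs =
    (\<Sum>t\<in>UNIV. Adv t *\<^sub>R
      (\<chi> b. (\<tau> * (of_bool (b = as t) - policy \<tau> \<phi> C b (xs t))) *\<^sub>R \<phi> (xs t)))"
  by (simp add: vec_eq_iff matrix_matrix_mult_def transpose_def Lambda_matrix_def
      feature_matrix_def mult.assoc)

lemma GDERIV_surrogate:
  fixes xs :: "'t::finite \<Rightarrow> 'x" and as :: "'t \<Rightarrow> 'a::finite"
  shows "GDERIV (surrogate \<tau> \<phi> xs as Adv) C :>
    transpose (Lambda_matrix \<tau> \<phi> xs as Adv C) ** feature_matrix \<phi> xs"
  unfolding transpose_Lambda_matrix_mult_feature_matrix gderiv_def surrogate_def[abs_def]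
    inner_sum_right inner_scaleR_right
  by (intro has_derivative_sum has_derivative_mult_right GDERIV_ln_policy[unfolded gderiv_def])

theorem proposition1:
  fixes \<tau> \<eta> :: real
    and \<phi> :: "'x \<Rightarrow> real^'d"
    and xs :: "'t::finite \<Rightarrow> 'x"
    and as :: "'t \<Rightarrow> 'a::finite"
    and Adv :: "'t \<Rightarrow> real"
    and C :: "real^'d^'a"
  assumes "\<tau> > 0" and "\<eta> > 0"
    and "\<And>x. norm (\<phi> x) = 1"
  shows "let J = surrogate \<tau> \<phi> xs as Adv;
             S = feature_matrix \<phi> xs;
             \<Lambda> = Lambda_matrix \<tau> \<phi> xs as Adv C
         in
           (GDERIV J C :> (transpose \<Lambda> ** S)) \<and>
           gradient J C = transpose \<Lambda> ** S \<and>
           ((\<forall>a. (C + \<eta> *\<^sub>R (transpose \<Lambda> ** S)) $ a \<noteq> 0) \<longrightarrow>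
            (\<forall>a u. is_arg_min (\<lambda>v. dist v ((C + \<eta> *\<^sub>R gradient J C) $ a)) (\<lambda>v. norm v = 1) u
                     \<longleftrightarrow> u = row_norm (C + \<eta> *\<^sub>R (transpose \<Lambda> ** S)) $ a))"
proof -
  let ?G = "transpose (Lambda_matrix \<tau> \<phi> xs as Adv C) ** feature_matrix \<phi> xs"
  have "gradient (surrogate \<tau> \<phi> xs as Adv) C = ?G"
    by (rule gradient_eqI) (rule GDERIV_surrogate)
  then show ?thesis
    \<comment> \<open>Each row of the updated matrix is kept as a single term, so that the
      nonzero-row assumption directly supplies \<open>m \<noteq> 0\<close> in the sphere
      lemma.\<close>
    by (simp add: Let_def GDERIV_surrogate is_arg_min_dist_sphere_iff row_norm_def
        del: vector_add_component vector_scaleR_component)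
qed

end
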